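(* Let $\Gamma$ be a link-regular finite simplicial graph with maximum clique size $d$. Let $\ell_0=|V\Gamma|$ and, for $1\le k\le d$, let $\ell_k=|\mathrm{Lk}(\sigma)|$ for any $k$-clique $\sigma$. For integers $0\le m\le d$ and $0\le k\le m$ set \[ N_{m,k}=\begin{cases}\left(\prod_{k<j<m}\ell_j\right)\sum_{j=k}^{m}\binom{m-k}{j-k}(-1)^{j-k}\ell_j & \text{if } k<m-1,\\ \ell_{m-1}-\ell_m-1 & \text{if } k=m-1,\\ 1 & \text{if } k=m,\end{cases} \] and for integers $0\le i\le d$, $0\le j\le i$ set $M_{i,i}=1$ and, for $i\ne j$, \[ M_{i,j}=\sum_{\substack{j\le s_1<t_1\le s_2<t_2\le\dots\le s_n<t_n\le d\\ (t_1-s_1)+\dots+(t_n-s_n)=i-j}}(-1)^n\binom{t_1}{s_1}\cdots\binom{t_n}{s_n}N_{t_1,s_1}\cdots N_{t_n,s_n} \] (the sum over all $n\ge1$ and all such integer sequences). Then the geodesic growth series of $\mathrm{RACG}(\Gamma)$ is the rational function \[ \mathcal{G}(z)=\frac{\sum_{i=0}^{d}\left(\sum_{j=0}^{i}\ell_0\cdots\ell_{j-1}M_{i,j}\right)z^i}{\sum_{i=0}^{d}M_{i,0}z^i}, \] where $\ell_0\cdots\ell_{j-1}$ is interpreted as $1$ when $j=0$.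
   Context: For a finite simplicial graph $\Gamma$, $\mathrm{RACG}(\Gamma)$ is the right-angled Coxeter group $\langle v\in V\Gamma\mid v^2=1,\ uv=vu \text{ for } \{u,v\}\in E\Gamma\rangle$ with standard generating set $V\Gamma$. A word over $V\Gamma$ is a geodesic if no shorter word represents the same element; the geodesic growth series is $\sum_n a_n z^n$ with $a_n$ the number of geodesic words of length $n$. A $k$-clique is a set of $k$ vertices spanning a complete subgraph; $\mathrm{Lk}(\sigma)=\{v\in V\Gamma\setminus\sigma\mid \sigma\cup\{v\}\text{ is a clique}\}$. $\Gamma$ is link-regular if any two cliques of the same size have links of the same size. *)

theory Defs
  imports "HOL-Algebra.Group" "HOL-Computational_Algebra.Polynomial_FPS"
begin

section \<open>Finite simplicial graphs, cliques and links\<close>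

definition simplicial_graph :: "'a set \<Rightarrow> 'a set set \<Rightarrow> bool" where
  "simplicial_graph V E \<longleftrightarrow> finite V \<and> (\<forall>e\<in>E. e \<subseteq> V \<and> card e = 2)"

text \<open>The empty set is a clique (the only one of size 0), and its link is \<open>V\<close>.\<close>

definition clique :: "'a set \<Rightarrow> 'a set set \<Rightarrow> 'a set \<Rightarrow> bool" where
  "clique V E \<sigma> \<longleftrightarrow> \<sigma> \<subseteq> V \<and> (\<forall>u\<in>\<sigma>. \<forall>v\<in>\<sigma>. u \<noteq> v \<longrightarrow> {u, v} \<in> E)"

definition link :: "'a set \<Rightarrow> 'a set set \<Rightarrow> 'a set \<Rightarrow> 'a set" where
  "link V E \<sigma> = {v \<in> V - \<sigma>. clique V E (insert v \<sigma>)}"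

definition max_clique_size :: "'a set \<Rightarrow> 'a set set \<Rightarrow> nat" where
  "max_clique_size V E = Max (card ` {\<sigma>. clique V E \<sigma>})"

definition link_regular :: "'a set \<Rightarrow> 'a set set \<Rightarrow> bool" where
  "link_regular V E \<longleftrightarrow>
     (\<forall>\<sigma> \<tau>. clique V E \<sigma> \<and> clique V E \<tau> \<and> card \<sigma> = card \<tau> \<longrightarrow>
        card (link V E \<sigma>) = card (link V E \<tau>))"


section \<open>Groups given by generators and relations\<close>

text \<open>
  A letter is a pair \<open>(s, b)\<close>, standing for the generator \<open>s\<close> if \<open>b\<close> is true and for its formal
  inverse otherwise. A relation \<open>x = y\<close> is a pair \<open>(x, y)\<close> of words. The congruence below is the one
  generated by free cancellation and by the relations, so that the quotient is
  the group with presentation \<open>\<langle>S | R\<rangle>\<close>.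
\<close>

definition group_words :: "'a set \<Rightarrow> ('a \<times> bool) list set" where
  "group_words S = lists (S \<times> UNIV)"

inductive_set pres_rel ::
    "'a set \<Rightarrow> (('a \<times> bool) list \<times> ('a \<times> bool) list) set \<Rightarrow>
       (('a \<times> bool) list \<times> ('a \<times> bool) list) set"
  for S :: "'a set" and R :: "(('a \<times> bool) list \<times> ('a \<times> bool) list) set" where
  pres_refl: "w \<in> group_words S \<Longrightarrow> (w, w) \<in> pres_rel S R"
| pres_sym: "(v, w) \<in> pres_rel S R \<Longrightarrow> (w, v) \<in> pres_rel S R"
| pres_trans: "(u, v) \<in> pres_rel S R \<Longrightarrow> (v, w) \<in> pres_rel S R \<Longrightarrow> (u, w) \<in> pres_rel S R"
| pres_cancel: "u \<in> group_words S \<Longrightarrow> v \<in> group_words S \<Longrightarrow> s \<in> S \<Longrightarrow>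
    (u @ [(s, b), (s, \<not> b)] @ v, u @ v) \<in> pres_rel S R"
| pres_relation: "u \<in> group_words S \<Longrightarrow> v \<in> group_words S \<Longrightarrow> (x, y) \<in> R \<Longrightarrow>
    x \<in> group_words S \<Longrightarrow> y \<in> group_words S \<Longrightarrow>
    (u @ x @ v, u @ y @ v) \<in> pres_rel S R"

definition presented_group ::
    "'a set \<Rightarrow> (('a \<times> bool) list \<times> ('a \<times> bool) list) set \<Rightarrow> ('a \<times> bool) list set monoid" where
  "presented_group S R =
     \<lparr>carrier = group_words S // pres_rel S R,
      monoid.mult = (\<lambda>A B. \<Union>a\<in>A. \<Union>b\<in>B. pres_rel S R `` {a @ b}),
      monoid.one = pres_rel S R `` {[]}\<rparr>"

definition presented_gen ::
    "'a set \<Rightarrow> (('a \<times> bool) list \<times> ('a \<times> bool) list) set \<Rightarrow> 'a \<Rightarrow> ('a \<times> bool) list set" where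
  "presented_gen S R s = pres_rel S R `` {[(s, True)]}"

lemma group_words_simps [simp]:
  "[] \<in> group_words S"
  "p # w \<in> group_words S \<longleftrightarrow> fst p \<in> S \<and> w \<in> group_words S"
  "u @ v \<in> group_words S \<longleftrightarrow> u \<in> group_words S \<and> v \<in> group_words S"
  by (auto simp: group_words_def mem_Times_iff)

lemma pres_rel_words:
  "(v, w) \<in> pres_rel S R \<Longrightarrow> v \<in> group_words S \<and> w \<in> group_words S"
  by (induction rule: pres_rel.induct) auto

lemma equiv_pres_rel: "equiv (group_words S) (pres_rel S R)"
proof (rule equivI)
  show "pres_rel S R \<subseteq> group_words S \<times> group_words S"
    using pres_rel_words by fast
  show "refl_on (group_words S) (pres_rel S R)"
    by (intro refl_onI pres_refl)
  show "sym (pres_rel S R)"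
    by (intro symI) (rule pres_sym)
  show "trans (pres_rel S R)"
    by (intro transI) (rule pres_trans)
qed

lemma pres_rel_append_right:
  "(v, w) \<in> pres_rel S R \<Longrightarrow> x \<in> group_words S \<Longrightarrow> (v @ x, w @ x) \<in> pres_rel S R"
proof (induction rule: pres_rel.induct)
  case (pres_cancel u v s b)
  then show ?case using pres_rel.pres_cancel[of u S "v @ x" s b R] by simp
next
  case (pres_relation u v y z)
  then show ?case using pres_rel.pres_relation[of u S "v @ x" y z R] by simp
next
  case (pres_refl w)
  then show ?case by (intro pres_rel.pres_refl) simp
next
  case (pres_sym v w)
  show ?case by (rule pres_rel.pres_sym[OF pres_sym.IH]) (fact pres_sym.prems)
next
  case (pres_trans u v w)
  show ?case
    by (rule pres_rel.pres_trans[OF pres_trans.IH(1) pres_trans.IH(2)]) (fact pres_trans.prems)+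
qed

lemma pres_rel_append_left:
  "(v, w) \<in> pres_rel S R \<Longrightarrow> x \<in> group_words S \<Longrightarrow> (x @ v, x @ w) \<in> pres_rel S R"
proof (induction rule: pres_rel.induct)
  case (pres_cancel u v s b)
  then show ?case using pres_rel.pres_cancel[of "x @ u" S v s b R] by simp
next
  case (pres_relation u v y z)
  then show ?case using pres_rel.pres_relation[of "x @ u" S v y z R] by simp
next
  case (pres_refl w)
  then show ?case by (intro pres_rel.pres_refl) simp
next
  case (pres_sym v w)
  show ?case by (rule pres_rel.pres_sym[OF pres_sym.IH]) (fact pres_sym.prems)
next
  case (pres_trans u v w)
  show ?case
    by (rule pres_rel.pres_trans[OF pres_trans.IH(1) pres_trans.IH(2)]) (fact pres_trans.prems)+
qed

lemma presented_group_mult: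
  assumes "a \<in> group_words S" "b \<in> group_words S"
  shows "pres_rel S R `` {a} \<otimes>\<^bsub>presented_group S R\<^esub> pres_rel S R `` {b} = pres_rel S R `` {a @ b}"
proof -
  have const: "pres_rel S R `` {x @ y} = pres_rel S R `` {a @ b}"
    if "(a, x) \<in> pres_rel S R" "(b, y) \<in> pres_rel S R" for x y
  proof -
    have "(a @ b, x @ b) \<in> pres_rel S R" "(x @ b, x @ y) \<in> pres_rel S R"
      using that assms pres_rel_words[OF that(1)]
      by (simp_all add: pres_rel_append_left pres_rel_append_right)
    then have "(a @ b, x @ y) \<in> pres_rel S R"
      by (rule pres_trans)
    then show ?thesis
      by (rule equiv_class_eq[OF equiv_pres_rel, symmetric])
  qed
  have "(\<Union>x\<in>pres_rel S R `` {a}. \<Union>y\<in>pres_rel S R `` {b}. pres_rel S R `` {x @ y}) =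
        (\<Union>x\<in>pres_rel S R `` {a}. \<Union>y\<in>pres_rel S R `` {b}. pres_rel S R `` {a @ b})"
    by (intro SUP_cong refl const) simp_all
  also have "\<dots> = pres_rel S R `` {a @ b}"
    using assms pres_refl[of a S R] pres_refl[of b S R] by blast
  finally show ?thesis
    by (simp add: presented_group_def)
qed

lemma pres_rel_inverse:
  "w \<in> group_words S \<Longrightarrow>
     (rev (map (\<lambda>(s, b). (s, \<not> b)) w) @ w, []) \<in> pres_rel S R"
proof (induction w)
  case Nil
  show ?case by (simp add: pres_refl)
next
  case (Cons p w)
  obtain s b where p: "p = (s, b)" by (cases p)
  let ?v = "rev (map (\<lambda>(s, b). (s, \<not> b)) w)"
  have "?v \<in> group_words S"
    using Cons.prems by (auto simp: group_words_def)
  then have "(?v @ [(s, \<not> b), (s, \<not> \<not> b)] @ w, ?v @ w) \<in> pres_rel S R"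
    using Cons.prems p by (intro pres_cancel) simp_all
  moreover have "(?v @ w, []) \<in> pres_rel S R"
    using Cons by simp
  ultimately have "(?v @ [(s, \<not> b), (s, \<not> \<not> b)] @ w, []) \<in> pres_rel S R"
    by (rule pres_trans)
  then show ?case by (simp add: p)
qed

lemma group_presented_group: "group (presented_group S R)"
proof (rule groupI)
  have carrier: "carrier (presented_group S R) = group_words S // pres_rel S R"
    and one: "\<one>\<^bsub>presented_group S R\<^esub> = pres_rel S R `` {[]}"
    by (auto simp: presented_group_def)
  note mult = presented_group_mult[of _ S _ R]
  show "\<one>\<^bsub>presented_group S R\<^esub> \<in> carrier (presented_group S R)"
    by (auto simp: carrier one intro: quotientI)
  fix x assume "x \<in> carrier (presented_group S R)"
  then obtain a where a: "a \<in> group_words S" "x = pres_rel S R `` {a}"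
    by (auto simp: carrier elim: quotientE)
  show "\<one>\<^bsub>presented_group S R\<^esub> \<otimes>\<^bsub>presented_group S R\<^esub> x = x"
    using a by (simp add: one mult)
  show "\<exists>y\<in>carrier (presented_group S R).
          y \<otimes>\<^bsub>presented_group S R\<^esub> x = \<one>\<^bsub>presented_group S R\<^esub>"
  proof
    let ?b = "rev (map (\<lambda>(s, b). (s, \<not> b)) a)"
    have b: "?b \<in> group_words S"
      using a by (auto simp: group_words_def)
    then show "pres_rel S R `` {?b} \<in> carrier (presented_group S R)"
      by (auto simp: carrier intro: quotientI)
    show "pres_rel S R `` {?b} \<otimes>\<^bsub>presented_group S R\<^esub> x = \<one>\<^bsub>presented_group S R\<^esub>"
      using a b pres_rel_inverse[OF a(1), of R]
      by (simp add: mult one equiv_class_eq[OF equiv_pres_rel])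
  qed
  fix y assume "y \<in> carrier (presented_group S R)"
  then obtain b where b: "b \<in> group_words S" "y = pres_rel S R `` {b}"
    by (auto simp: carrier elim: quotientE)
  show "x \<otimes>\<^bsub>presented_group S R\<^esub> y \<in> carrier (presented_group S R)"
    using a b by (auto simp: mult carrier intro: quotientI)
  fix z assume "z \<in> carrier (presented_group S R)"
  then obtain c where c: "c \<in> group_words S" "z = pres_rel S R `` {c}"
    by (auto simp: carrier elim: quotientE)
  show "x \<otimes>\<^bsub>presented_group S R\<^esub> y \<otimes>\<^bsub>presented_group S R\<^esub> z =
        x \<otimes>\<^bsub>presented_group S R\<^esub> (y \<otimes>\<^bsub>presented_group S R\<^esub> z)"
    using a b c by (simp add: mult)
qed


section \<open>Right-angled Coxeter groups and geodesic growth\<close>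

definition racg_relations ::
    "'a set \<Rightarrow> 'a set set \<Rightarrow> (('a \<times> bool) list \<times> ('a \<times> bool) list) set" where
  "racg_relations V E =
     {([(v, True), (v, True)], []) | v. v \<in> V} \<union>
     {([(u, True), (v, True)], [(v, True), (u, True)]) | u v. {u, v} \<in> E}"

definition RACG :: "'a set \<Rightarrow> 'a set set \<Rightarrow> ('a \<times> bool) list set monoid" where
  "RACG V E = presented_group V (racg_relations V E)"

definition racg_gen :: "'a set \<Rightarrow> 'a set set \<Rightarrow> 'a \<Rightarrow> ('a \<times> bool) list set" where
  "racg_gen V E v = presented_gen V (racg_relations V E) v"

definition racg_eval :: "'a set \<Rightarrow> 'a set set \<Rightarrow> 'a list \<Rightarrow> ('a \<times> bool) list set" where
  "racg_eval V E w = foldr (\<lambda>v g. racg_gen V E v \<otimes>\<^bsub>RACG V E\<^esub> g) w \<one>\<^bsub>RACG V E\<^esub>"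

definition racg_geodesic :: "'a set \<Rightarrow> 'a set set \<Rightarrow> 'a list \<Rightarrow> bool" where
  "racg_geodesic V E w \<longleftrightarrow>
     w \<in> lists V \<and>
     (\<nexists>w'. w' \<in> lists V \<and> length w' < length w \<and> racg_eval V E w' = racg_eval V E w)"

definition geodesic_growth_series :: "'a set \<Rightarrow> 'a set set \<Rightarrow> rat fps" where
  "geodesic_growth_series V E =
     Abs_fps (\<lambda>n. of_nat (card {w. racg_geodesic V E w \<and> length w = n}))"


section \<open>The coefficients N and M\<close>

text \<open>Relevant only for \<open>k \<le> m\<close>, where the final case below means \<open>k = m\<close>.\<close>

definition coeff_N :: "(nat \<Rightarrow> nat) \<Rightarrow> nat \<Rightarrow> nat \<Rightarrow> rat" where
  "coeff_N l m k =
     (if k + 1 < m then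
        (\<Prod>j\<in>{k<..<m}. of_nat (l j)) *
        (\<Sum>j=k..m. of_nat ((m - k) choose (j - k)) * (-1) ^ (j - k) * of_nat (l j))
      else if k + 1 = m then of_nat (l (m - 1)) - of_nat (l m) - 1
      else 1)"

text \<open>
  The index set of the sum: the list \<open>[(s\<^sub>1, t\<^sub>1), \<dots>, (s\<^sub>n, t\<^sub>n)]\<close> encodes the
  sequence \<open>j \<le> s\<^sub>1 < t\<^sub>1 \<le> s\<^sub>2 < t\<^sub>2 \<le> \<dots> \<le> s\<^sub>n < t\<^sub>n \<le> d\<close> with \<open>n \<ge> 1\<close>. Requiring
  \<open>t\<^sub>a \<le> s\<^sub>b\<close> for all positions \<open>a < b\<close> is the same as requiring it for consecutive ones.
\<close>

definition index_chains :: "nat \<Rightarrow> nat \<Rightarrow> nat \<Rightarrow> (nat \<times> nat) list set" where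
  "index_chains d i j =
     {xs. xs \<noteq> [] \<and>
          (\<forall>(s, t)\<in>set xs. j \<le> s \<and> s < t \<and> t \<le> d) \<and>
          sorted_wrt (\<lambda>(s, t) (s', t'). t \<le> s') xs \<and>
          (\<Sum>(s, t)\<leftarrow>xs. t - s) = i - j}"

definition coeff_M :: "(nat \<Rightarrow> nat) \<Rightarrow> nat \<Rightarrow> nat \<Rightarrow> nat \<Rightarrow> rat" where
  "coeff_M l d i j =
     (if i = j then 1
      else \<Sum>xs\<in>index_chains d i j.
             (-1) ^ length xs * (\<Prod>(s, t)\<leftarrow>xs. of_nat (t choose s) * coeff_N l t s))"

text \<open>The sum defining \<^const>\<open>coeff_M\<close> is over a finite set.\<close>

lemma finite_index_chains: "finite (index_chains d i j)"
proof (rule finite_subset)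
  show "index_chains d i j \<subseteq> {xs. set xs \<subseteq> {..d} \<times> {..d} \<and> length xs \<le> i - j}"
  proof
    fix xs assume xs: "xs \<in> index_chains d i j"
    then have "\<forall>(s, t)\<in>set xs. s < t" "(\<Sum>(s, t)\<leftarrow>xs. t - s) = i - j"
      by (auto simp: index_chains_def)
    moreover have length_le: "length ys \<le> (\<Sum>(s, t)\<leftarrow>ys. t - s)"
      if "\<forall>(s, t)\<in>set ys. s < t" for ys :: "(nat \<times> nat) list"
      using that by (induction ys) auto
    ultimately have "length xs \<le> i - j"
      using length_le[of xs] by simp
    moreover have "set xs \<subseteq> {..d} \<times> {..d}"
      using xs by (force simp: index_chains_def)
    ultimately show "xs \<in> {xs. set xs \<subseteq> {..d} \<times> {..d} \<and> length xs \<le> i - j}"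
      by simp
  qed
  show "finite {xs. set xs \<subseteq> {..d} \<times> {..d} \<and> length xs \<le> i - j}"
    by (rule finite_lists_length_le) simp
qed

end

theory Submission
  imports Defs
begin

text \<open>
  A word in a right-angled Coxeter group is geodesic iff no two equal letters in it are separated
  only by letters adjacent to them. Such words are recognised by an automaton
  whose states are the cliques: the state of a word is its set of possible first letters, and
  prefixing \<open>v \<notin> \<sigma>\<close> to a word with state \<open>\<sigma>\<close> gives the state \<open>{v} \<union> (\<sigma> \<inter> Lk(v))\<close>. Link-regularity
  makes the number of transitions from an \<open>m\<close>-clique to \<open>(k+1)\<close>-cliques depend on \<open>m\<close> and \<open>k\<close> only.
  If \<open>F\<^sub>m\<close> counts the extensions of a word whose state is an \<open>m\<close>-clique, and
  \<open>G\<^sub>m = \<ell>\<^sub>0\<cdots>\<ell>\<^sub>m\<^sub>-\<^sub>1 F\<^sub>m\<close>, then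
  \<open>G\<^sub>m = \<ell>\<^sub>0\<cdots>\<ell>\<^sub>m\<^sub>-\<^sub>1 + z \<Sum>\<^bsub>k\<le>m\<^esub> (m choose k) N\<^bsub>m,k\<^esub> G\<^bsub>k+1\<^esub>\<close>. This almost triangular system is solved
  by summing it against the chain polynomials \<open>P\<^sub>j = \<Sum>\<^sub>i M\<^bsub>i,j\<^esub> z\<^bsup>i-j\<^esup>\<close>, which satisfy the transposed
  recursion.
\<close>

section \<open>Geodesic words\<close>

text \<open>
  Piles encode words up to commutation: pile \<open>x\<close> records the letters that do not commute with \<open>x\<close>,
  the letter \<open>x\<close> itself being marked by \<open>True\<close>.
\<close>

definition push :: "'a set set \<Rightarrow> 'a \<Rightarrow> ('a \<Rightarrow> bool list) \<Rightarrow> 'a \<Rightarrow> bool list" where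
  "push E v p = (\<lambda>x. if x = v then True # p x else if {x, v} \<in> E then p x else False # p x)"

definition pop :: "'a set set \<Rightarrow> 'a \<Rightarrow> ('a \<Rightarrow> bool list) \<Rightarrow> 'a \<Rightarrow> bool list" where
  "pop E v p = (\<lambda>x. if x \<noteq> v \<and> {x, v} \<in> E then p x else tl (p x))"

text \<open>On the pile of a word this is its state: the letters that commutations can bring to the
  front.\<close>

definition top_set :: "('a \<Rightarrow> bool list) \<Rightarrow> 'a set" where
  "top_set p = {v. p v \<noteq> [] \<and> hd (p v)}"

text \<open>Left multiplication by \<open>v\<close>, read on piles: since v^2 = 1, a
  \<open>v\<close> on top cancels, and otherwise the letter is added.\<close>

definition toggle :: "'a set set \<Rightarrow> 'a \<Rightarrow> ('a \<Rightarrow> bool list) \<Rightarrow> 'a \<Rightarrow> bool list" where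
  "toggle E v p = (if v \<in> top_set p then pop E v p else push E v p)"

primrec pile :: "'a set set \<Rightarrow> 'a list \<Rightarrow> 'a \<Rightarrow> bool list" where
  "pile E [] = (\<lambda>_. [])"
| "pile E (v # w) = push E v (pile E w)"

primrec reduced_word :: "'a set set \<Rightarrow> 'a list \<Rightarrow> bool" where
  "reduced_word E [] \<longleftrightarrow> True"
| "reduced_word E (v # w) \<longleftrightarrow> v \<notin> top_set (pile E w) \<and> reduced_word E w"

text \<open>The set on which the group will act. On arbitrary functions toggling is no involution,
  because \<open>push\<close> need not undo \<open>pop\<close>.\<close>

definition reduced_piles :: "'a set \<Rightarrow> 'a set set \<Rightarrow> ('a \<Rightarrow> bool list) set" where
  "reduced_piles V E = pile E ` {w \<in> lists V. reduced_word E w}"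

lemma pop_push [simp]: "pop E v (push E v p) = p"
  by (auto simp: pop_def push_def)

lemma top_set_push: "top_set (push E v p) = insert v {u \<in> top_set p. {u, v} \<in> E}"
  by (auto simp: top_set_def push_def)

lemma toggle_push [simp]: "toggle E v (push E v p) = p"
  by (simp add: toggle_def top_set_push)

lemma push_commute:
  assumes "{u, v} \<in> E" "u \<noteq> v"
  shows "push E u (push E v p) = push E v (push E u p)"
  using assms by (auto simp: push_def insert_commute)

section \<open>Commuting and cancelling letters\<close>

abbreviation plain :: "'a list \<Rightarrow> ('a \<times> bool) list" where
  "plain w \<equiv> map (\<lambda>v. (v, True)) w"

lemma plain_group_words [simp]: "plain w \<in> group_words V \<longleftrightarrow> w \<in> lists V"
  by (induction w) auto

lemma pres_rel_Cons:
  assumes "(plain x, plain y) \<in> pres_rel V R" "v \<in> V"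
  shows "(plain (v # x), plain (v # y)) \<in> pres_rel V R"
  using pres_rel_append_left[OF assms(1), of "[(v, True)]"] assms(2) by simp

lemma racg_rel_square:
  assumes "v \<in> V" "w \<in> lists V"
  shows "(plain (v # v # w), plain w) \<in> pres_rel V (racg_relations V E)"
  using pres_relation[of "[]" V "plain w" "[(v, True), (v, True)]" "[]" "racg_relations V E"] assms
  by (simp add: racg_relations_def)

lemma racg_rel_commute:
  assumes "{u, v} \<in> E" "u \<in> V" "v \<in> V" "w \<in> lists V"
  shows "(plain (u # v # w), plain (v # u # w)) \<in> pres_rel V (racg_relations V E)"
proof -
  have "([(u, True), (v, True)], [(v, True), (u, True)]) \<in> racg_relations V E"
    using assms by (auto simp: racg_relations_def)
  from pres_relation[OF _ _ this, of "[]" V "plain w"] show ?thesis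
    using assms by simp
qed

text \<open>Induction on \<open>w\<close>: if its first letter \<open>u\<close> is not
  \<open>v\<close>, then \<open>u\<close> is adjacent to \<open>v\<close> and \<open>v\<close> is on
  top of the tail, so \<open>v\<close> comes to the front of the tail and is then swapped with
  \<open>u\<close>.\<close>

lemma reduced_word_move_to_front:
  assumes "reduced_word E w" "w \<in> lists V" "v \<in> top_set (pile E w)"
  obtains w' where "reduced_word E (v # w')" "v # w' \<in> lists V" "length w = length (v # w')"
    "pile E w = pile E (v # w')"
    "(plain w, plain (v # w')) \<in> pres_rel V (racg_relations V E)"
proof -
  have "\<exists>w'. reduced_word E (v # w') \<and> v # w' \<in> lists V \<and> length w = length (v # w') \<and>
    pile E w = pile E (v # w') \<and> (plain w, plain (v # w')) \<in> pres_rel V (racg_relations V E)"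
    using assms
  proof (induction w)
    case Nil
    then show ?case by (simp add: top_set_def)
  next
    case (Cons u w)
    show ?case
    proof (cases "u = v")
      case True
      then show ?thesis
        using Cons.prems pres_refl[of "plain (v # w)" V] by (intro exI[of _ w]) simp
    next
      case False
      then have adj: "{u, v} \<in> E" and "v \<in> top_set (pile E w)"
        using Cons.prems by (auto simp: top_set_push insert_commute)
      with Cons obtain w' where w': "reduced_word E (v # w')" "v # w' \<in> lists V"
        "length w = length (v # w')" "pile E w = pile E (v # w')"
        "(plain w, plain (v # w')) \<in> pres_rel V (racg_relations V E)"
        by auto
      have "(plain (u # w), plain (u # v # w')) \<in> pres_rel V (racg_relations V E)"
        using w'(5) Cons.prems(2) by (intro pres_rel_Cons) auto
      moreover have "(plain (u # v # w'), plain (v # u # w')) \<in> pres_rel V (racg_relations V E)"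
        using adj w'(2) Cons.prems(2) by (intro racg_rel_commute) auto
      ultimately have "(plain (u # w), plain (v # u # w')) \<in> pres_rel V (racg_relations V E)"
        by (rule pres_trans)
      \<comment> \<open>If \<open>u\<close> were on top of \<open>w'\<close>, then, being adjacent
        to \<open>v\<close>, it would be on top of \<open>v # w'\<close> and hence of
        \<open>w\<close>.\<close>
      moreover have "reduced_word E (v # u # w')"
        using Cons.prems(1) w'(1,4) False adj by (auto simp: top_set_push)
      moreover have "pile E (u # w) = pile E (v # u # w')"
        using push_commute[OF adj False] w'(4) by simp
      ultimately show ?thesis
        using w'(2,3) Cons.prems(2) by (intro exI[of _ "u # w'"]) auto
    qed
  qed
  then show thesis using that by blast
qed

text \<open>Bringing \<open>v\<close> to the front leaves the pile unchanged, so on reduced piles a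
  letter on top always comes from a genuine push, and \<open>toggle_push\<close> applies.\<close>

lemma reduced_pilesE:
  assumes "p \<in> reduced_piles V E" "v \<in> top_set p"
  obtains q where "p = push E v q" "q \<in> reduced_piles V E" "v \<notin> top_set q"
proof -
  obtain w where w: "w \<in> lists V" "reduced_word E w" "p = pile E w"
    using assms(1) by (auto simp: reduced_piles_def)
  then obtain w' where "reduced_word E (v # w')" "v # w' \<in> lists V" "pile E w = pile E (v # w')"
    using reduced_word_move_to_front assms(2) by metis
  then show thesis
    using w by (intro that[of "pile E w'"]) (auto simp: reduced_piles_def)
qed

lemma reduced_piles_push:
  assumes "p \<in> reduced_piles V E" "v \<in> V" "v \<notin> top_set p"
  shows "push E v p \<in> reduced_piles V E"
proof -
  obtain w where "w \<in> lists V" "reduced_word E w" "p = pile E w"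
    using assms(1) by (auto simp: reduced_piles_def)
  then show ?thesis
    unfolding reduced_piles_def using assms by (intro image_eqI[of _ _ "v # w"]) auto
qed

lemma reduced_piles_toggle:
  assumes "p \<in> reduced_piles V E" "v \<in> V"
  shows "toggle E v p \<in> reduced_piles V E"
proof (cases "v \<in> top_set p")
  case True
  with assms(1) obtain q where "p = push E v q" "q \<in> reduced_piles V E"
    by (rule reduced_pilesE)
  then show ?thesis by simp
next
  case False
  then show ?thesis using assms by (simp add: toggle_def reduced_piles_push)
qed

lemma toggle_toggle:
  assumes "p \<in> reduced_piles V E"
  shows "toggle E v (toggle E v p) = p"
proof (cases "v \<in> top_set p")
  case True
  with assms obtain q where "p = push E v q" "v \<notin> top_set q"
    by (rule reduced_pilesE)
  then show ?thesis by (simp add: toggle_def[of E v q])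
next
  case False
  then show ?thesis by (simp add: toggle_def[of E v p])
qed

text \<open>
  If \<open>v\<close> is on top then \<open>p = push E v q\<close>, otherwise toggling \<open>v\<close> is a push before and after toggling
  \<open>u\<close>: both cases reduce to toggling \<open>u\<close> commuting with pushing \<open>v\<close>.
\<close>

lemma toggle_commute:
  assumes "p \<in> reduced_piles V E" "{u, v} \<in> E" "u \<noteq> v"
  shows "toggle E u (toggle E v p) = toggle E v (toggle E u p)"
proof -
  have adj: "{v, u} \<in> E" using assms(2) by (simp add: insert_commute)
  have push: "toggle E u (push E v q) = push E v (toggle E u q)"
    if "q \<in> reduced_piles V E" "{u, v} \<in> E" "u \<noteq> v" for u v q
  proof (cases "u \<in> top_set q")
    case True
    with that(1) obtain r where "q = push E u r"
      by (rule reduced_pilesE)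
    then show ?thesis using push_commute[OF that(2,3)] toggle_push by metis
  next
    case False
    then show ?thesis using that push_commute[OF that(2,3)] by (simp add: toggle_def top_set_push)
  qed
  show ?thesis
  proof (cases "v \<in> top_set p")
    case True
    with assms(1) obtain q where "p = push E v q" "q \<in> reduced_piles V E"
      by (rule reduced_pilesE)
    then show ?thesis using push[OF _ assms(2,3)] by simp
  next
    case False
    then have "v \<notin> top_set (toggle E u p)"
    proof (cases "u \<in> top_set p")
      case True
      with assms(1) obtain q where "p = push E u q"
        by (rule reduced_pilesE)
      then show ?thesis using False adj by (simp add: top_set_push)
    next
      case u: False
      then show ?thesis using False assms(3) by (simp add: toggle_def top_set_push)
    qed
    then show ?thesis using False push[OF assms] by (simp add: toggle_def[of E v])
  qed
qed

text \<open>\<open>foldr\<close> lets the last letter act first, as in a left action. The exponent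
  is dropped by \<open>fst\<close> since every generator acts as an involution on reduced
  piles.\<close>

definition act :: "'a set set \<Rightarrow> ('a \<times> bool) list \<Rightarrow> ('a \<Rightarrow> bool list) \<Rightarrow> 'a \<Rightarrow> bool list" where
  "act E w p = foldr (toggle E \<circ> fst) w p"

lemma act_simps [simp]:
  "act E [] p = p"
  "act E (a # w) p = toggle E (fst a) (act E w p)"
  "act E (u @ w) p = act E u (act E w p)"
  by (simp_all add: act_def)

lemma act_reduced_piles:
  assumes "w \<in> group_words V" "p \<in> reduced_piles V E"
  shows "act E w p \<in> reduced_piles V E"
  using assms by (induction w) (auto intro: reduced_piles_toggle)

text \<open>It suffices to check the generators of the congruence: cancellations and squares act
  trivially by \<open>toggle_toggle\<close>, and commutations are respected by
  \<open>toggle_commute\<close>. The right-hand context only moves the starting pile within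
  \<open>reduced_piles\<close>.\<close>

lemma act_pres_rel:
  assumes "simplicial_graph V E" "(x, y) \<in> pres_rel V (racg_relations V E)"
    and "p \<in> reduced_piles V E"
  shows "act E x p = act E y p"
  using assms(2)
proof (induction rule: pres_rel.induct)
  case (pres_cancel u w s b)
  then show ?case
    using act_reduced_piles[OF _ assms(3), of w] by (simp add: toggle_toggle[where V = V])
next
  case (pres_relation u w x y)
  have mem: "act E w p \<in> reduced_piles V E"
    using pres_relation assms(3) by (simp add: act_reduced_piles)
  from pres_relation(3) consider
      v where "x = [(v, True), (v, True)]" "y = []"
    | a b where "{a, b} \<in> E" "x = [(a, True), (b, True)]" "y = [(b, True), (a, True)]"
    by (auto simp: racg_relations_def)
  then show ?case
  proof cases
    case 1
    then show ?thesis by (simp add: toggle_toggle[OF mem])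
  next
    case (2 a b)
    \<comment> \<open>Edges of a simplicial graph have two endpoints, which excludes the loop case
      \<open>a = b\<close>.\<close>
    moreover have "card {a, b} = 2"
      using assms(1) 2(1) by (auto simp: simplicial_graph_def)
    then have "a \<noteq> b" by (auto simp: card_insert_if)
    ultimately show ?thesis using mem 
      by (simp add: toggle_commute[OF mem 2(1) \<open>a \<noteq> b\<close>])
  qed
qed simp_all

lemma act_eq_pile:
  assumes "reduced_word E w"
  shows "act E (plain w) (\<lambda>_. []) = pile E w"
  using assms by (induction w) (auto simp: toggle_def)

text \<open>The induction carries a reduced word with the current pile; each toggle either prefixes
  a letter to it, or brings that letter to the front and deletes it.\<close>

lemma act_length_le:
  assumes "w \<in> lists V"
  obtains w' where "w' \<in> lists V" "length w' \<le> length w" "act E (plain w) (\<lambda>_. []) = pile E w'"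
proof -
  have "\<exists>w'\<in>lists V. reduced_word E w' \<and> length w' \<le> length w \<and>
    act E (plain w) (\<lambda>_. []) = pile E w'"
    using assms
  proof (induction w)
    case Nil
    show ?case by (intro bexI[of _ "[]"]) auto
  next
    case (Cons v w)
    then have "v \<in> V" by simp
    from Cons obtain x where x: "x \<in> lists V" "reduced_word E x" "length x \<le> length w"
      "act E (plain w) (\<lambda>_. []) = pile E x" by auto
    show ?case
    proof (cases "v \<in> top_set (pile E x)")
      case True
      with x obtain y where "reduced_word E (v # y)" "v # y \<in> lists V" "length x = length (v # y)"
        "pile E x = pile E (v # y)"
        using reduced_word_move_to_front by metis
      with x show ?thesis by (intro bexI[of _ y]) auto
    next
      case False
      with x \<open>v \<in> V\<close> show ?thesis
        by (intro bexI[of _ "v # x"]) (auto simp: toggle_def)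
    qed
  qed
  then show thesis using that by blast
qed

text \<open>Each letter puts exactly one \<open>True\<close> on the piles, namely on its own. Hence
  words over \<open>V\<close> with the same pile have the same length.\<close>

lemma length_eq_sum_pile:
  assumes "finite V" "w \<in> lists V"
  shows "length w = (\<Sum>x\<in>V. count_list (pile E w x) True)"
  using assms(2)
proof (induction w)
  case (Cons v w)
  have "(\<Sum>x\<in>V. count_list (pile E (v # w) x) True) =
        (\<Sum>x\<in>V. (if x = v then 1 else 0) + count_list (pile E w x) True)"
    by (intro sum.cong) (auto simp: push_def)
  also have "\<dots> = length (v # w)"
    using Cons assms(1) by (simp add: sum.distrib)
  finally show ?case ..
qed simp

section \<open>Geodesics are the reduced words\<close>

lemma racg_eval_eq_class:
  assumes "w \<in> lists V"
  shows "racg_eval V E w = pres_rel V (racg_relations V E) `` {plain w}"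
  using assms
proof (induction w)
  case Nil
  show ?case by (simp add: racg_eval_def RACG_def presented_group_def)
next
  case (Cons v w)
  then show ?case
    using presented_group_mult[of "[(v, True)]" V "plain w" "racg_relations V E"]
    by (simp add: racg_eval_def racg_gen_def RACG_def presented_gen_def)
qed

lemma racg_eval_eq_iff:
  assumes "w \<in> lists V" "w' \<in> lists V"
  shows "racg_eval V E w = racg_eval V E w' \<longleftrightarrow>
    (plain w, plain w') \<in> pres_rel V (racg_relations V E)"
  using assms by (simp add: racg_eval_eq_class eq_equiv_class_iff[OF equiv_pres_rel])

text \<open>At the first violation, counted from the right, the offending letter \<open>v\<close>
  precedes a reduced tail in which another \<open>v\<close> can be brought to the front, and the two
  cancel.\<close>

lemma shorten_not_reduced:
  assumes "w \<in> lists V" "\<not> reduced_word E w"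
  shows "\<exists>w'\<in>lists V. length w' < length w \<and>
    (plain w, plain w') \<in> pres_rel V (racg_relations V E)"
  using assms
proof (induction w rule: list.induct)
  case (Cons v w)
  show ?case
  proof (cases "reduced_word E w")
    case True
    have w: "w \<in> lists V" "v \<in> top_set (pile E w)"
      using Cons.prems True by simp_all
    obtain y where y: "v # y \<in> lists V" "length w = length (v # y)"
      "(plain w, plain (v # y)) \<in> pres_rel V (racg_relations V E)"
      by (rule reduced_word_move_to_front[OF True w]) (rule that)
    have "(plain (v # w), plain (v # v # y)) \<in> pres_rel V (racg_relations V E)"
      by (rule pres_rel_Cons) (use y Cons.prems in simp_all)
    moreover have "(plain (v # v # y), plain y) \<in> pres_rel V (racg_relations V E)"
      by (rule racg_rel_square) (use y in simp_all)
    ultimately have "(plain (v # w), plain y) \<in> pres_rel V (racg_relations V E)"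
      by (rule pres_trans)
    then show ?thesis using y(1,2) by (intro bexI[of _ y]) simp_all
  next
    case False
    with Cons obtain w' where w': "w' \<in> lists V" "length w' < length w"
      "(plain w, plain w') \<in> pres_rel V (racg_relations V E)" by auto
    then have "(plain (v # w), plain (v # w')) \<in> pres_rel V (racg_relations V E)"
      using Cons.prems by (intro pres_rel_Cons) auto
    then show ?thesis using w'(1,2) Cons.prems by (intro bexI[of _ "v # w'"]) simp_all
  qed
qed simp_all

text \<open>A non-reduced word can be shortened. Conversely, acting on the empty pile makes the pile
  of a reduced word an invariant of its group element: any other representative yields a word with
  this pile that is no longer than the representative, and the pile fixes the length.\<close>

theorem racg_geodesic_iff_reduced:
  assumes "simplicial_graph V E"
  shows "racg_geodesic V E w \<longleftrightarrow> w \<in> lists V \<and> reduced_word E w"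
proof
  assume geo: "racg_geodesic V E w"
  then have w: "w \<in> lists V" by (simp only: racg_geodesic_def)
  have "reduced_word E w"
  proof (rule ccontr)
    assume "\<not> reduced_word E w"
    from shorten_not_reduced[OF w this] obtain w' where w': "w' \<in> lists V" "length w' < length w"
      "(plain w, plain w') \<in> pres_rel V (racg_relations V E)"
      by blast
    then have "racg_eval V E w' = racg_eval V E w"
      using racg_eval_eq_iff[OF w w'(1), of E] by simp
    then show False
      using geo w' unfolding racg_geodesic_def by blast
  qed
  with w show "w \<in> lists V \<and> reduced_word E w" ..
next
  assume "w \<in> lists V \<and> reduced_word E w"
  then have w: "w \<in> lists V" and red: "reduced_word E w" by blast+
  have empty: "(\<lambda>_. []) \<in> reduced_piles V E"
    unfolding reduced_piles_def by (intro image_eqI[of _ _ "[]"]) auto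
  have "length w \<le> length w'" if w': "w' \<in> lists V" "racg_eval V E w' = racg_eval V E w" for w'
  proof -
    obtain y where y: "y \<in> lists V" "length y \<le> length w'"
      "act E (plain w') (\<lambda>_. []) = pile E y"
      using act_length_le[OF w'(1)] .
    have "(plain w', plain w) \<in> pres_rel V (racg_relations V E)"
      using w'(2) racg_eval_eq_iff[OF w'(1) w, of E] by blast
    from act_pres_rel[OF assms this empty] have "pile E y = pile E w"
      by (simp only: y(3) act_eq_pile[OF red])
    then have "length y = length w"
      using assms by (simp only: simplicial_graph_def length_eq_sum_pile[of V _ E] y(1) w)
    with y(2) show ?thesis by simp
  qed
  then show "racg_geodesic V E w"
    using w unfolding racg_geodesic_def by (meson not_less)
qed

section \<open>Transitions between clique states\<close>

lemma link_eq:
  assumes "clique V E \<sigma>"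
  shows "link V E \<sigma> = {v \<in> V - \<sigma>. \<forall>u\<in>\<sigma>. {u, v} \<in> E}"
  using assms by (auto simp: link_def clique_def insert_commute)

lemma clique_subset: "clique V E \<sigma> \<Longrightarrow> \<tau> \<subseteq> \<sigma> \<Longrightarrow> clique V E \<tau>"
  unfolding clique_def by blast

lemma clique_top_set:
  assumes "w \<in> lists V"
  shows "clique V E (top_set (pile E w))"
  using assms
proof (induction w)
  case Nil
  show ?case by (simp add: clique_def top_set_def)
next
  case (Cons v w)
  then show ?case by (auto simp: clique_def top_set_push insert_commute)
qed

section \<open>Cliques of maximum size\<close>

lemma finite_cliques:
  assumes "simplicial_graph V E"
  shows "finite {\<sigma>. clique V E \<sigma>}"
  by (rule finite_subset[of _ "Pow V"]) (use assms in \<open>auto simp: clique_def simplicial_graph_def\<close>)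

lemma clique_card_le:
  assumes "simplicial_graph V E" "clique V E \<sigma>"
  shows "card \<sigma> \<le> max_clique_size V E"
  unfolding max_clique_size_def using finite_cliques[OF assms(1)] assms(2) by (intro Max_ge) auto

lemma max_clique_exists:
  assumes "simplicial_graph V E"
  obtains \<sigma> where "clique V E \<sigma>" "card \<sigma> = max_clique_size V E"
proof -
  have "clique V E {}" by (simp add: clique_def)
  then have "card ` {\<sigma>. clique V E \<sigma>} \<noteq> {}" by auto
  then have "max_clique_size V E \<in> card ` {\<sigma>. clique V E \<sigma>}"
    unfolding max_clique_size_def using finite_cliques[OF assms] by (intro Max_in) auto
  then show thesis using that by auto
qed

lemma link_max_clique:
  assumes "simplicial_graph V E" "clique V E \<sigma>" "card \<sigma> = max_clique_size V E"
  shows "link V E \<sigma> = {}"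
proof (rule ccontr)
  assume "link V E \<sigma> \<noteq> {}"
  then obtain v where "v \<notin> \<sigma>" "clique V E (insert v \<sigma>)" by (auto simp: link_def)
  moreover have "finite \<sigma>"
    using assms by (auto simp: clique_def simplicial_graph_def intro: finite_subset)
  ultimately show False
    using clique_card_le[OF assms(1), of "insert v \<sigma>"] assms(3) by simp
qed

text \<open>Binomial inversion recovers the number of \<open>v\<close> with \<open>s v = k\<close> from the binomial moments of \<open>s\<close>.\<close>

lemma alternating_binomial_delta:
  assumes "s \<le> m"
  shows "(\<Sum>j=k..m. (-1) ^ (j - k) * of_nat (j choose k) * of_nat (s choose j)) =
    (if s = k then 1 else 0 :: rat)"
proof (cases "k \<le> s")
  case False
  then show ?thesis by (auto intro!: sum.neutral simp: binomial_eq_0)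
next
  case True
  have "(\<Sum>j=k..m. (-1) ^ (j - k) * of_nat (j choose k) * of_nat (s choose j) :: rat) =
        (\<Sum>j=k..s. (-1) ^ (j - k) * of_nat (j choose k) * of_nat (s choose j))"
    using assms by (intro sum.mono_neutral_right) auto
  \<comment> \<open>Trinomial revision pulls out \<open>s choose k\<close> and leaves an alternating
    row sum, which is 0 unless \<open>s = k\<close>.\<close>
  also have "\<dots> = (\<Sum>j=k..s. of_nat (s choose k) * ((-1) ^ (j - k) * of_nat ((s - k) choose (j - k))))"
  proof (intro sum.cong refl)
    fix j assume "j \<in> {k..s}"
    then have "(s choose j) * (j choose k) = (s choose k) * ((s - k) choose (j - k))"
      by (intro choose_mult) auto
    from arg_cong[OF this, of "of_nat :: nat \<Rightarrow> rat"]
    show "(-1) ^ (j - k) * of_nat (j choose k) * of_nat (s choose j) =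
      (of_nat (s choose k) * ((-1) ^ (j - k) * of_nat ((s - k) choose (j - k))) :: rat)"
      by (simp add: algebra_simps)
  qed
  also have "\<dots> = of_nat (s choose k) * (\<Sum>i\<le>s - k. (-1) ^ i * of_nat ((s - k) choose i))"
    unfolding sum_distrib_left[symmetric]
    by (intro arg_cong2[of _ _ _ _ "(*)"] refl sum.reindex_bij_witness[of _ "\<lambda>i. i + k" "\<lambda>j. j - k"])
      (use True in auto)
  also have "\<dots> = (if s = k then 1 else 0)"
    using True choose_alternating_sum[of "s - k", where 'a = rat] by auto
  finally show ?thesis .
qed

text \<open>Binomial inversion formula for the number of vertices outside an \<open>m\<close>-clique
  with exactly \<open>k\<close> neighbours in it. The factor after the sign and
  \<open>j choose k\<close> is the \<open>j\<close>-th binomial moment computed in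
  \<open>sum_choose_neighbours\<close>.\<close>

definition transitions :: "(nat \<Rightarrow> nat) \<Rightarrow> nat \<Rightarrow> nat \<Rightarrow> rat" where
  "transitions l m k =
    (\<Sum>j=k..m. (-1) ^ (j - k) * of_nat (j choose k) * (of_nat (m choose j) * (of_nat (l j) - of_nat (m - j))))"

lemma of_nat_card_filter:
  assumes "finite A"
  shows "of_nat (card {x \<in> A. P x}) = (\<Sum>x\<in>A. if P x then 1 else 0 :: 'b :: semiring_1)"
  by (subst sum.inter_filter[OF assms, symmetric]) simp

text \<open>Double counting of pairs of a \<open>j\<close>-subset of the clique and an outside
  vertex adjacent to all of it. The link of such a subset consists of these outside vertices and of
  the remaining vertices of the clique, whence the correction
  \<open>card \<sigma> - j\<close>.\<close>

lemma sum_choose_neighbours: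
  assumes "finite V" "clique V E \<sigma>"
    and "\<And>\<tau>. \<tau> \<subseteq> \<sigma> \<Longrightarrow> card (link V E \<tau>) = l (card \<tau>)" and "j \<le> card \<sigma>"
  shows "(\<Sum>v\<in>V - \<sigma>. of_nat (card {u \<in> \<sigma>. {u, v} \<in> E} choose j)) =
    (of_nat (card \<sigma> choose j) * (of_nat (l j) - of_nat (card \<sigma> - j)) :: rat)"
proof -
  have fin: "finite \<sigma>" using assms(1,2) by (auto simp: clique_def intro: finite_subset)
  let ?T = "{\<tau>. \<tau> \<subseteq> \<sigma> \<and> card \<tau> = j}"
  let ?adj = "\<lambda>\<tau> v. \<forall>u\<in>\<tau>. {u, v} \<in> E"
  have "(\<Sum>v\<in>V - \<sigma>. of_nat (card {u \<in> \<sigma>. {u, v} \<in> E} choose j)) =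
    (\<Sum>v\<in>V - \<sigma>. of_nat (card {\<tau> \<in> ?T. ?adj \<tau> v}) :: rat)"
  proof (intro sum.cong refl)
    fix v
    have "{\<tau> \<in> ?T. ?adj \<tau> v} = {\<tau>. \<tau> \<subseteq> {u \<in> \<sigma>. {u, v} \<in> E} \<and> card \<tau> = j}" by auto
    then show "of_nat (card {u \<in> \<sigma>. {u, v} \<in> E} choose j) = (of_nat (card {\<tau> \<in> ?T. ?adj \<tau> v}) :: rat)"
      using fin by (simp add: n_subsets)
  qed
  also have "\<dots> = (\<Sum>v\<in>V - \<sigma>. \<Sum>\<tau>\<in>?T. if ?adj \<tau> v then 1 else 0)"
    by (intro sum.cong refl of_nat_card_filter) (simp add: fin)
  also have "\<dots> = (\<Sum>\<tau>\<in>?T. \<Sum>v\<in>V - \<sigma>. if ?adj \<tau> v then 1 else 0)"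
    by (rule sum.swap)
  also have "\<dots> = (\<Sum>\<tau>\<in>?T. of_nat (card {v \<in> V - \<sigma>. ?adj \<tau> v}))"
    by (intro sum.cong refl of_nat_card_filter[symmetric]) (simp add: assms(1))
  also have "\<dots> = (\<Sum>\<tau>\<in>?T. of_nat (l j) - of_nat (card \<sigma> - j))"
  proof (intro sum.cong refl)
    fix \<tau> assume "\<tau> \<in> ?T"
    then have \<tau>: "\<tau> \<subseteq> \<sigma>" "card \<tau> = j" by auto
    have "{u, v} \<in> E" if "u \<in> \<tau>" "v \<in> \<sigma> - \<tau>" for u v
    proof -
      have "u \<in> \<sigma>" "v \<in> \<sigma>" "u \<noteq> v" using that \<tau>(1) by auto
      then show ?thesis using assms(2) by (simp add: clique_def)
    qed
    moreover have "\<sigma> \<subseteq> V" using assms(2) by (simp add: clique_def)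
    ultimately have "link V E \<tau> = {v \<in> V - \<sigma>. ?adj \<tau> v} \<union> (\<sigma> - \<tau>)"
      unfolding link_eq[OF clique_subset[OF assms(2) \<tau>(1)]]
      using \<tau>(1) by auto
    moreover have "card ({v \<in> V - \<sigma>. ?adj \<tau> v} \<union> (\<sigma> - \<tau>)) =
        card {v \<in> V - \<sigma>. ?adj \<tau> v} + card (\<sigma> - \<tau>)"
      using fin assms(1) by (intro card_Un_disjoint) auto
    ultimately have "l j = card {v \<in> V - \<sigma>. ?adj \<tau> v} + card (\<sigma> - \<tau>)"
      using assms(3)[OF \<tau>(1)] \<tau>(2) by simp
    also have "card (\<sigma> - \<tau>) = card \<sigma> - j"
      using \<tau> fin by (simp add: card_Diff_subset finite_subset)
    finally show "of_nat (card {v \<in> V - \<sigma>. ?adj \<tau> v}) = (of_nat (l j) - of_nat (card \<sigma> - j) :: rat)"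
      by simp
  qed
  also have "\<dots> = of_nat (card \<sigma> choose j) * (of_nat (l j) - of_nat (card \<sigma> - j))"
    using fin by (simp add: n_subsets)
  finally show ?thesis .
qed

lemma card_transitions:
  assumes "finite V" "clique V E \<sigma>"
    and "\<And>\<tau>. \<tau> \<subseteq> \<sigma> \<Longrightarrow> card (link V E \<tau>) = l (card \<tau>)"
  shows "of_nat (card {v \<in> V - \<sigma>. card {u \<in> \<sigma>. {u, v} \<in> E} = k}) = transitions l (card \<sigma>) k"
proof -
  have fin: "finite \<sigma>" using assms(1,2) by (auto simp: clique_def intro: finite_subset)
  let ?s = "\<lambda>v. card {u \<in> \<sigma>. {u, v} \<in> E}"
  have "of_nat (card {v \<in> V - \<sigma>. ?s v = k}) = (\<Sum>v\<in>V - \<sigma>. if ?s v = k then 1 else 0 :: rat)"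
    by (rule of_nat_card_filter) (simp add: assms(1))
  also have "\<dots> = (\<Sum>v\<in>V - \<sigma>. \<Sum>j=k..card \<sigma>.
      (-1) ^ (j - k) * of_nat (j choose k) * of_nat (?s v choose j))"
    using fin by (intro sum.cong refl alternating_binomial_delta[symmetric] card_mono) auto
  also have "\<dots> = transitions l (card \<sigma>) k"
    unfolding transitions_def
    by (subst sum.swap)
      (auto simp: sum_distrib_left[symmetric] sum_choose_neighbours[OF assms] intro!: sum.cong)
  finally show ?thesis .
qed

text \<open>The corrections \<open>m - j\<close> add up to \<open>?B\<close>, which is 1 for
  \<open>k = m - 1\<close> and 0 for smaller \<open>k\<close>. This is where the exceptional case of
  \<open>coeff_N\<close> and its \<open>- 1\<close> come from.\<close>

lemma transitions_coeff_N:
  assumes "k < m"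
  shows "(\<Prod>j\<in>{k<..<m}. of_nat (l j)) * transitions l m k = of_nat (m choose k) * coeff_N l m k"
proof -
  let ?sgn = "\<lambda>j. (-1) ^ (j - k) :: rat"
  let ?A = "\<Sum>j=k..m. of_nat ((m - k) choose (j - k)) * ?sgn j * of_nat (l j)"
  let ?B = "\<Sum>j=k..m. of_nat ((m - k) choose (j - k)) * ?sgn j * of_nat (m - j)"
  have "transitions l m k = (\<Sum>j=k..m. of_nat (m choose k) *
     (of_nat ((m - k) choose (j - k)) * ?sgn j * of_nat (l j) -
      of_nat ((m - k) choose (j - k)) * ?sgn j * of_nat (m - j)))"
    unfolding transitions_def
  proof (intro sum.cong refl)
    fix j assume "j \<in> {k..m}"
    then have "(m choose j) * (j choose k) = (m choose k) * ((m - k) choose (j - k))"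
      by (intro choose_mult) auto
    from arg_cong[OF this, of "of_nat :: nat \<Rightarrow> rat"]
    have eq: "of_nat (m choose j) * of_nat (j choose k) =
      (of_nat (m choose k) * of_nat ((m - k) choose (j - k)) :: rat)" by simp
    have "?sgn j * of_nat (j choose k) * (of_nat (m choose j) * (of_nat (l j) - of_nat (m - j))) =
      ?sgn j * (of_nat (m choose j) * of_nat (j choose k)) * (of_nat (l j) - of_nat (m - j))"
      by (simp add: algebra_simps)
    also have "\<dots> = of_nat (m choose k) *
     (of_nat ((m - k) choose (j - k)) * ?sgn j * of_nat (l j) -
      of_nat ((m - k) choose (j - k)) * ?sgn j * of_nat (m - j))"
      unfolding eq by (simp add: algebra_simps)
    finally show "?sgn j * of_nat (j choose k) * (of_nat (m choose j) * (of_nat (l j) - of_nat (m - j))) =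
      \<dots>" .
  qed
  also have "\<dots> = of_nat (m choose k) * (?A - ?B)"
    by (simp only: sum_distrib_left[symmetric] sum_subtractf)
  finally have tr: "transitions l m k = of_nat (m choose k) * (?A - ?B)" .
  show ?thesis
  proof (cases "k + 1 = m")
    case True
    then have "{k..m} = {k, m}" by auto
    moreover have "{k<..<m} = {}" using True by auto
    ultimately show ?thesis unfolding tr using True[symmetric] by (simp add: coeff_N_def)
  next
    case False
    with assms obtain r where r: "m - k = Suc r" "0 < r"
      by (metis Suc_diff_Suc Suc_eq_plus1 diff_is_0_eq le_less_Suc_eq less_eq_Suc_le neq0_conv not_less)
    have "?B = (\<Sum>i\<le>Suc r. of_nat (Suc r choose i) * (-1) ^ i * of_nat (Suc r - i))"
      by (rule sum.reindex_bij_witness[of _ "\<lambda>i. i + k" "\<lambda>j. j - k"]) (use r assms in auto)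
    also have "\<dots> = (\<Sum>i\<le>r. of_nat (Suc r choose i) * (-1) ^ i * of_nat (Suc r - i))"
      by simp
    \<comment> \<open>Absorption replaces the weight \<open>Suc r - i\<close> by the constant
      \<open>Suc r\<close>, leaving the alternating sum of row \<open>r\<close>, which vanishes
      because \<open>r > 0\<close>.\<close>
    also have "\<dots> = (\<Sum>i\<le>r. of_nat (Suc r) * ((-1) ^ i * of_nat (r choose i)))"
    proof (intro sum.cong refl)
      fix i assume "i \<in> {..r}"
      then have "(Suc r - i) * (Suc r choose i) = Suc r * (r choose i)"
        using binomial_absorb_comp[of "Suc r" i] by simp
      from arg_cong[OF this, of "of_nat :: nat \<Rightarrow> rat"]
      show "of_nat (Suc r choose i) * (-1) ^ i * of_nat (Suc r - i) =
        (of_nat (Suc r) * ((-1) ^ i * of_nat (r choose i)) :: rat)"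
        by (simp only: of_nat_mult mult_ac)
    qed
    also have "\<dots> = 0"
      unfolding sum_distrib_left[symmetric]
      using choose_alternating_sum[OF r(2), where 'a = rat] by simp
    finally have "?B = 0" .
    then show ?thesis
      unfolding tr using False assms by (simp add: coeff_N_def mult_ac)
  qed
qed

lemma transitions_diag: "transitions l m m = of_nat (l m)"
  by (simp add: transitions_def)

section \<open>Counting extensions of reduced words\<close>

text \<open>\<open>extensions l n m\<close> counts the ways of prefixing \<open>n\<close> letters to a reduced word whose state is an
  \<open>m\<close>-clique.\<close>

primrec extensions :: "(nat \<Rightarrow> nat) \<Rightarrow> nat \<Rightarrow> nat \<Rightarrow> rat" where
  "extensions l 0 m = 1"
| "extensions l (Suc n) m = (\<Sum>k\<le>m. transitions l m k * extensions l n (Suc k))"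

text \<open>Induction on \<open>n\<close>, splitting off the last letter \<open>v\<close> of the
  extension, the one next to \<open>w\<close>. If \<open>v\<close> has \<open>k\<close> neighbours
  in the state, the new state has \<open>k + 1\<close> elements, and by
  \<open>card_transitions\<close> the number of such \<open>v\<close> depends only on
  \<open>k\<close> and the size of the state.\<close>

lemma card_extensions:
  assumes "finite V" "\<And>\<tau>. clique V E \<tau> \<Longrightarrow> card (link V E \<tau>) = l (card \<tau>)"
    and "w \<in> lists V" "reduced_word E w"
  shows "of_nat (card {x \<in> lists V. length x = n \<and> reduced_word E (x @ w)}) =
    extensions l n (card (top_set (pile E w)))"
  using assms(3,4)
proof (induction n arbitrary: w)
  case 0
  then have "{x \<in> lists V. length x = 0 \<and> reduced_word E (x @ w)} = {[]}" by auto
  then show ?case by simp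
next
  case (Suc n)
  let ?X = "\<lambda>n w. {x \<in> lists V. length x = n \<and> reduced_word E (x @ w)}"
  let ?\<sigma> = "top_set (pile E w)"
  let ?s = "\<lambda>v. card {u \<in> ?\<sigma>. {u, v} \<in> E}"
  have clq: "clique V E ?\<sigma>" using Suc.prems(1) by (rule clique_top_set)
  then have fin: "finite ?\<sigma>" using assms(1) by (auto simp: clique_def intro: finite_subset)
  have suffix: "reduced_word E y" if "reduced_word E (x @ y)" for x y
    using that by (induction x) auto
  have finX: "finite (?X n w)" for n w
    by (rule finite_subset[OF _ finite_lists_length_eq[OF assms(1), of n]]) auto
  have "?X (Suc n) w = (\<Union>v\<in>V - ?\<sigma>. (\<lambda>y. y @ [v]) ` ?X n (v # w))"
  proof (intro equalityI subsetI)
    fix x assume x: "x \<in> ?X (Suc n) w"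
    then obtain y v where "x = y @ [v]" by (cases x rule: rev_cases) auto
    moreover from this x suffix[of y "v # w"] have "v \<in> V - ?\<sigma>" "y \<in> ?X n (v # w)" by auto
    ultimately show "x \<in> (\<Union>v\<in>V - ?\<sigma>. (\<lambda>y. y @ [v]) ` ?X n (v # w))" by blast
  qed auto
  then have "card (?X (Suc n) w) = (\<Sum>v\<in>V - ?\<sigma>. card ((\<lambda>y. y @ [v]) ` ?X n (v # w)))"
    using assms(1) finX by (simp only:) (rule card_UN_disjoint; auto)
  also have "\<dots> = (\<Sum>v\<in>V - ?\<sigma>. card (?X n (v # w)))"
    by (intro sum.cong refl card_image) (simp add: inj_on_def)
  finally have "of_nat (card (?X (Suc n) w)) = (\<Sum>v\<in>V - ?\<sigma>. of_nat (card (?X n (v # w))) :: rat)"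
    by simp
  also have "\<dots> = (\<Sum>v\<in>V - ?\<sigma>. extensions l n (Suc (?s v)))"
  proof (intro sum.cong refl)
    fix v assume v: "v \<in> V - ?\<sigma>"
    then have "of_nat (card (?X n (v # w))) = extensions l n (card (top_set (pile E (v # w))))"
      using Suc.prems by (intro Suc.IH) auto
    also have "card (top_set (pile E (v # w))) = Suc (?s v)"
      using v fin by (simp add: top_set_push)
    finally show "of_nat (card (?X n (v # w))) = extensions l n (Suc (?s v))" .
  qed
  also have "\<dots> = (\<Sum>k\<le>card ?\<sigma>. \<Sum>v\<in>{v \<in> V - ?\<sigma>. ?s v = k}. extensions l n (Suc (?s v)))"
    using assms(1) fin by (intro sum.group[symmetric]) (auto intro: card_mono)
  also have "\<dots> = (\<Sum>k\<le>card ?\<sigma>. transitions l (card ?\<sigma>) k * extensions l n (Suc k))"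
  proof (intro sum.cong refl)
    fix k
    have "(\<Sum>v\<in>{v \<in> V - ?\<sigma>. ?s v = k}. extensions l n (Suc (?s v))) =
      of_nat (card {v \<in> V - ?\<sigma>. ?s v = k}) * extensions l n (Suc k)"
      by simp
    also have "of_nat (card {v \<in> V - ?\<sigma>. ?s v = k}) = transitions l (card ?\<sigma>) k"
      using assms(2) clique_subset[OF clq] by (intro card_transitions[OF assms(1) clq]) auto
    finally show "(\<Sum>v\<in>{v \<in> V - ?\<sigma>. ?s v = k}. extensions l n (Suc (?s v))) =
      transitions l (card ?\<sigma>) k * extensions l n (Suc k)" .
  qed
  finally show ?case by simp
qed

text \<open>The series \<open>G\<^sub>m\<close>.\<close>

definition ext_series :: "(nat \<Rightarrow> nat) \<Rightarrow> nat \<Rightarrow> rat fps" where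
  "ext_series l m = fps_const (\<Prod>r<m. of_nat (l r)) * Abs_fps (\<lambda>n. extensions l n m)"

text \<open>The prefactor avoids any division: for \<open>k < m\<close> it splits into the prefactor
  of \<open>k + 1\<close> and the product over \<open>{k<..<m}\<close>, which
  \<open>transitions_coeff_N\<close> absorbs. The term \<open>k = m\<close> supplies just the next
  factor \<open>l m\<close>, and so stands apart.\<close>

lemma ext_series_rec:
  "ext_series l m = fps_const (\<Prod>r<m. of_nat (l r)) + fps_X * ext_series l (Suc m) +
    fps_X * (\<Sum>k<m. fps_const (of_nat (m choose k) * coeff_N l m k) * ext_series l (Suc k))"
proof (rule fps_ext)
  fix n
  let ?L = "\<lambda>m. \<Prod>r<m. of_nat (l r) :: rat"
  show "fps_nth (ext_series l m) n = fps_nth (fps_const (?L m) + fps_X * ext_series l (Suc m) +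
    fps_X * (\<Sum>k<m. fps_const (of_nat (m choose k) * coeff_N l m k) * ext_series l (Suc k))) n"
  proof (cases n)
    case 0
    then show ?thesis by (simp add: ext_series_def)
  next
    case (Suc i)
    have eq: "?L m * (transitions l m k * extensions l i (Suc k)) =
      of_nat (m choose k) * coeff_N l m k * (?L (Suc k) * extensions l i (Suc k))"
      if "k < m" for k
    proof -
      have "{..<m} = {..<Suc k} \<union> {k<..<m}" using that by auto
      moreover have "prod f ({..<Suc k} \<union> {k<..<m}) = prod f {..<Suc k} * prod f {k<..<m}"
        for f :: "nat \<Rightarrow> rat"
        by (rule prod.union_disjoint) auto
      ultimately have "?L m = ?L (Suc k) * (\<Prod>j\<in>{k<..<m}. of_nat (l j))"
        by (simp only:)
      then have "?L m * (transitions l m k * extensions l i (Suc k)) =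
        ?L (Suc k) * ((\<Prod>j\<in>{k<..<m}. of_nat (l j)) * transitions l m k) * extensions l i (Suc k)"
        by (simp only: mult.assoc)
      then show ?thesis
        unfolding transitions_coeff_N[OF that] by (simp only: mult_ac)
    qed
    have "fps_nth (ext_series l m) n = (\<Sum>k\<le>m. ?L m * (transitions l m k * extensions l i (Suc k)))"
      unfolding Suc by (simp add: ext_series_def sum_distrib_left)
    also have "\<dots> = ?L (Suc m) * extensions l i (Suc m) +
      (\<Sum>k<m. ?L m * (transitions l m k * extensions l i (Suc k)))"
    proof -
      have "{..m} = insert m {..<m}" by auto
      then show ?thesis by (simp add: transitions_diag)
    qed
    also have "\<dots> = ?L (Suc m) * extensions l i (Suc m) +
      (\<Sum>k<m. of_nat (m choose k) * coeff_N l m k * (?L (Suc k) * extensions l i (Suc k)))"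
      by (intro arg_cong2[of _ _ _ _ "(+)"] sum.cong refl eq) simp
    finally show ?thesis
      unfolding Suc by (simp add: ext_series_def fps_sum_nth)
  qed
qed

section \<open>Chain polynomials\<close>

text \<open>Chains of all sizes at once, including the empty one, which accounts for the diagonal
  value 1 of \<open>coeff_M\<close>.\<close>

definition chains :: "nat \<Rightarrow> nat \<Rightarrow> (nat \<times> nat) list set" where
  "chains d j = {xs. (\<forall>(s, t)\<in>set xs. j \<le> s \<and> s < t \<and> t \<le> d) \<and> sorted_wrt (\<lambda>(s, t) (s', t'). t \<le> s') xs}"

definition chain_size :: "(nat \<times> nat) list \<Rightarrow> nat" where
  "chain_size xs = (\<Sum>(s, t)\<leftarrow>xs. t - s)"

definition chain_weight :: "(nat \<Rightarrow> nat) \<Rightarrow> (nat \<times> nat) list \<Rightarrow> rat" where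
  "chain_weight l xs = (-1) ^ length xs * (\<Prod>(s, t)\<leftarrow>xs. of_nat (t choose s) * coeff_N l t s)"

text \<open>The lower bound absorbs the order condition, so inductions on chains run with
  \<open>j\<close> varying.\<close>

lemma chains_Cons: "(s, t) # xs \<in> chains d j \<longleftrightarrow> j \<le> s \<and> s < t \<and> t \<le> d \<and> xs \<in> chains d t"
  by (force simp: chains_def)

lemma chain_size_le:
  assumes "xs \<in> chains d j"
  shows "chain_size xs \<le> d - j"
  using assms
proof (induction xs arbitrary: j)
  case Nil
  then show ?case by (simp add: chain_size_def)
next
  case (Cons x xs)
  obtain s t where x: "x = (s, t)" by (cases x)
  with Cons have "j \<le> s" "s < t" "t \<le> d" "chain_size xs \<le> d - t"
    by (auto simp: chains_Cons)
  then show ?case by (simp add: x chain_size_def)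
qed

lemma chain_size_eq_0:
  assumes "xs \<in> chains d j"
  shows "chain_size xs = 0 \<longleftrightarrow> xs = []"
  using assms by (cases xs) (auto simp: chains_def chain_size_def)

lemma Nil_in_chains [simp]: "[] \<in> chains d j"
  by (simp add: chains_def)

lemma index_chains_eq:
  assumes "j < i"
  shows "index_chains d i j = {xs \<in> chains d j. chain_size xs = i - j}"
  using assms by (auto simp: index_chains_def chains_def chain_size_def)

lemma finite_chains: "finite (chains d j)"
proof (rule finite_subset)
  show "chains d j \<subseteq> insert [] (\<Union>i\<in>{j<..d}. index_chains d i j)"
  proof
    fix xs assume xs: "xs \<in> chains d j"
    show "xs \<in> insert [] (\<Union>i\<in>{j<..d}. index_chains d i j)"
    proof (cases "xs = []")
      case False
      with xs have "0 < chain_size xs" using chain_size_eq_0 by blast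
      moreover have "chain_size xs \<le> d - j" using xs by (rule chain_size_le)
      ultimately have "xs \<in> index_chains d (j + chain_size xs) j" "j + chain_size xs \<in> {j<..d}"
        using xs by (auto simp: index_chains_eq)
      then show ?thesis by blast
    qed simp
  qed
qed (simp add: finite_index_chains)

lemma coeff_M_eq:
  assumes "j \<le> i"
  shows "coeff_M l d i j = (\<Sum>xs\<in>{xs \<in> chains d j. chain_size xs = i - j}. chain_weight l xs)"
proof (cases "i = j")
  case True
  have "{xs \<in> chains d j. chain_size xs = 0} = {[]}"
    using chain_size_eq_0 by auto
  then show ?thesis using True by (simp add: coeff_M_def chain_weight_def)
next
  case False
  then show ?thesis
    using assms by (simp add: coeff_M_def index_chains_eq chain_weight_def)
qed

text \<open>The series \<open>P\<^sub>j\<close>.\<close>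

definition chain_series :: "(nat \<Rightarrow> nat) \<Rightarrow> nat \<Rightarrow> nat \<Rightarrow> rat fps" where
  "chain_series l d j = (\<Sum>xs\<in>chains d j. fps_const (chain_weight l xs) * fps_X ^ chain_size xs)"

text \<open>Group the chains by size; since sizes are at most \<open>d - j\<close>, the index
  \<open>i = j + chain_size xs\<close> stays within \<open>{j..d}\<close>.\<close>

lemma chain_series_eq_coeff_M:
  assumes "j \<le> d"
  shows "chain_series l d j = (\<Sum>i=j..d. fps_const (coeff_M l d i j) * fps_X ^ (i - j))"
proof -
  let ?f = "\<lambda>xs. fps_const (chain_weight l xs) * fps_X ^ chain_size xs"
  have "chain_series l d j = (\<Sum>i=j..d. \<Sum>xs\<in>{xs \<in> chains d j. j + chain_size xs = i}. ?f xs)"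
    unfolding chain_series_def using finite_chains chain_size_le[of _ d j] assms
    by (intro sum.group[symmetric]) force+
  also have "\<dots> = (\<Sum>i=j..d. fps_const (coeff_M l d i j) * fps_X ^ (i - j))"
  proof (intro sum.cong refl)
    fix i assume "i \<in> {j..d}"
    then have "{xs \<in> chains d j. j + chain_size xs = i} = {xs \<in> chains d j. chain_size xs = i - j}"
      and "j \<le> i" by auto
    moreover have "fps_const (\<Sum>xs\<in>A. chain_weight l xs) = (\<Sum>xs\<in>A. fps_const (chain_weight l xs))"
      for A by (induction A rule: infinite_finite_induct) (simp_all flip: fps_const_add)
    ultimately show "(\<Sum>xs\<in>{xs \<in> chains d j. j + chain_size xs = i}. ?f xs) =
      fps_const (coeff_M l d i j) * fps_X ^ (i - j)"
      by (simp add: coeff_M_eq sum_distrib_right)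
  qed
  finally show ?thesis .
qed

text \<open>Split the chains according to whether they start at \<open>j\<close>.\<close>

lemma chain_series_rec:
  "chain_series l d j = chain_series l d (Suc j) -
    (\<Sum>t\<in>{j<..d}. fps_const (of_nat (t choose j) * coeff_N l t j) * fps_X ^ (t - j) * chain_series l d t)"
proof -
  let ?f = "\<lambda>xs. fps_const (chain_weight l xs) * fps_X ^ chain_size xs"
  let ?S = "\<Union>t\<in>{j<..d}. (#) (j, t) ` chains d t"
  have "chains d j = chains d (Suc j) \<union> ?S"
  proof (intro equalityI subsetI)
    fix xs assume "xs \<in> chains d j"
    then show "xs \<in> chains d (Suc j) \<union> ?S"
    proof (cases xs)
      case (Cons x ys)
      obtain s t where "x = (s, t)" by (cases x)
      with Cons \<open>xs \<in> chains d j\<close> show ?thesis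
        by (cases "s = j") (auto simp: chains_Cons)
    qed simp
  next
    fix xs assume "xs \<in> chains d (Suc j) \<union> ?S"
    then show "xs \<in> chains d j"
      by (cases xs) (auto simp: chains_Cons)
  qed
  moreover have "chains d (Suc j) \<inter> ?S = {}"
    by (auto simp: chains_Cons)
  ultimately have "chain_series l d j = chain_series l d (Suc j) + sum ?f ?S"
    unfolding chain_series_def using finite_chains by (simp add: sum.union_disjoint)
  also have "sum ?f ?S = (\<Sum>t\<in>{j<..d}. sum ?f ((#) (j, t) ` chains d t))"
    by (rule sum.UNION_disjoint) (auto simp: finite_chains)
  also have "\<dots> = (\<Sum>t\<in>{j<..d}. - (fps_const (of_nat (t choose j) * coeff_N l t j) *
     fps_X ^ (t - j) * chain_series l d t))"
  proof (intro sum.cong refl)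
    fix t
    have "sum ?f ((#) (j, t) ` chains d t) = (\<Sum>xs\<in>chains d t. ?f ((j, t) # xs))"
      by (subst sum.reindex) (auto simp: inj_on_def)
    \<comment> \<open>The minus sign is the one that an additional pair contributes to
      \<open>(-1) ^ length xs\<close>.\<close>
    also have "\<dots> = (\<Sum>xs\<in>chains d t. - (fps_const (of_nat (t choose j) * coeff_N l t j) *
     fps_X ^ (t - j) * ?f xs))"
      by (intro sum.cong refl)
        (simp add: chain_weight_def chain_size_def power_add mult_ac
          flip: fps_const_mult fps_const_neg)
    also have "\<dots> = - (fps_const (of_nat (t choose j) * coeff_N l t j) *
     fps_X ^ (t - j) * chain_series l d t)"
      by (simp add: chain_series_def sum_distrib_left sum_negf)
    finally show "sum ?f ((#) (j, t) ` chains d t) =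
      - (fps_const (of_nat (t choose j) * coeff_N l t j) * fps_X ^ (t - j) * chain_series l d t)" .
  qed
  finally show ?thesis by (simp add: sum_negf)
qed

text \<open>Abel summation: with \<open>h\<^sub>m = z\<^sup>m G\<^sub>m\<close>, sum \<open>P\<^sub>m (h\<^sub>m - h\<^bsub>m+1\<^esub>)\<close> over \<open>m \<le> d\<close> and use both recursions.\<close>

lemma ext_series_chain_series:
  assumes "ext_series l (Suc d) = 0"
  shows "ext_series l 0 * chain_series l d 0 =
    (\<Sum>m\<le>d. fps_const (\<Prod>r<m. of_nat (l r)) * fps_X ^ m * chain_series l d m)"
proof -
  let ?P = "chain_series l d"
  \<comment> \<open>The power of \<open>fps_X\<close> is chosen so that the recursion of the
    \<open>h m\<close> has coefficients \<open>b m k\<close> with exponent \<open>m - k\<close>, as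
    in \<open>chain_series_rec\<close>.\<close>
  define h where "h m = fps_X ^ m * ext_series l m" for m
  define c where "c m = fps_const (\<Prod>r<m. of_nat (l r) :: rat) * fps_X ^ m" for m
  define b where "b m k = fps_const (of_nat (m choose k) * coeff_N l m k) * fps_X ^ (m - k)" for m k
  have step: "h m - h (Suc m) = c m + (\<Sum>k<m. b m k * h (Suc k))" for m
  proof -
    have "h m - h (Suc m) = c m + (\<Sum>k<m. fps_X ^ m * (fps_X *
        (fps_const (of_nat (m choose k) * coeff_N l m k) * ext_series l (Suc k))))"
      unfolding h_def c_def
      by (subst ext_series_rec) (simp add: algebra_simps sum_distrib_left)
    also have "(\<Sum>k<m. fps_X ^ m * (fps_X *
        (fps_const (of_nat (m choose k) * coeff_N l m k) * ext_series l (Suc k)))) =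
        (\<Sum>k<m. b m k * h (Suc k))"
    proof (intro sum.cong refl)
      fix k assume "k \<in> {..<m}"
      then have "(fps_X :: rat fps) ^ m = fps_X ^ (m - k) * fps_X ^ k"
        by (simp flip: power_add)
      then show "fps_X ^ m * (fps_X *
        (fps_const (of_nat (m choose k) * coeff_N l m k) * ext_series l (Suc k))) = b m k * h (Suc k)"
        by (simp add: b_def h_def mult_ac)
    qed
    finally show ?thesis .
  qed
  have "(\<Sum>m\<le>d. ?P m * (h m - h (Suc m))) =
    (\<Sum>m\<le>d. ?P m * c m) + (\<Sum>m\<le>d. \<Sum>k<m. ?P m * b m k * h (Suc k))"
    by (simp add: step distrib_left sum.distrib sum_distrib_left mult.assoc)
  also have "(\<Sum>m\<le>d. \<Sum>k<m. ?P m * b m k * h (Suc k)) =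
    (\<Sum>k<d. \<Sum>m\<in>{k<..d}. ?P m * b m k * h (Suc k))"
    unfolding sum.Sigma[OF finite_atMost ballI[OF finite_lessThan]]
      sum.Sigma[OF finite_lessThan ballI[OF finite_greaterThanAtMost]]
    by (rule sum.reindex_bij_witness[of _ prod.swap prod.swap]) auto
  also have "\<dots> = (\<Sum>k<d. (?P (Suc k) - ?P k) * h (Suc k))"
  proof (intro sum.cong refl)
    fix k
    \<comment> \<open>After the exchange of summations the inner sum is that of
      \<open>chain_series_rec\<close>: the two recursions are transposes of each other.\<close>
    have "?P (Suc k) - ?P k = (\<Sum>m\<in>{k<..d}. ?P m * b m k)"
      by (simp add: chain_series_rec[of l d k] b_def mult_ac)
    then show "(\<Sum>m\<in>{k<..d}. ?P m * b m k * h (Suc k)) = (?P (Suc k) - ?P k) * h (Suc k)"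
      by (simp add: sum_distrib_right)
  qed
  finally have lhs: "(\<Sum>m\<le>d. ?P m * (h m - h (Suc m))) =
    (\<Sum>m\<le>d. ?P m * c m) + (\<Sum>k<d. (?P (Suc k) - ?P k) * h (Suc k))" .
  \<comment> \<open>Summation by parts. At \<open>n = d\<close> the boundary term vanishes by the
    assumption, and the sum of differences of \<open>?P\<close> cancels against the one in
    \<open>lhs\<close>.\<close>
  have "(\<Sum>m\<le>n. ?P m * (h m - h (Suc m))) =
    ?P 0 * h 0 + (\<Sum>k<n. (?P (Suc k) - ?P k) * h (Suc k)) - ?P n * h (Suc n)" for n
    by (induction n) (simp_all add: algebra_simps)
  from this[of d] have "?P 0 * h 0 = (\<Sum>m\<le>d. ?P m * c m)"
    using lhs assms by (simp add: h_def)
  then show ?thesis by (simp add: h_def c_def mult_ac)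
qed

section \<open>The growth series as a quotient of polynomials\<close>

lemma fps_of_poly_monom_eq: "fps_of_poly (monom c n) = fps_const c * fps_X ^ n"
  by (rule fps_ext) (auto simp: fps_X_power_nth)

theorem theorem6p4:
  fixes V :: "'a set" and E :: "'a set set" and d :: nat and l :: "nat \<Rightarrow> nat"
  assumes "simplicial_graph V E"
    and "link_regular V E"
    and "d = max_clique_size V E"
    and "l 0 = card V"
    and "\<And>k \<sigma>. 1 \<le> k \<Longrightarrow> k \<le> d \<Longrightarrow> clique V E \<sigma> \<Longrightarrow> card \<sigma> = k \<Longrightarrow> l k = card (link V E \<sigma>)"
  shows "geodesic_growth_series V E =
    fps_of_poly (\<Sum>i=0..d. monom (\<Sum>j=0..i. (\<Prod>r<j. of_nat (l r)) * coeff_M l d i j) i) /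
    fps_of_poly (\<Sum>i=0..d. monom (coeff_M l d i 0) i)"
proof -
  let ?L = "\<lambda>m. \<Prod>r<m. of_nat (l r) :: rat"
  have fin: "finite V" using assms(1) by (simp add: simplicial_graph_def)
  \<comment> \<open>The value \<open>l 0\<close> fits the same pattern, since the link of the empty
    clique is \<open>V\<close>.\<close>
  have link: "card (link V E \<tau>) = l (card \<tau>)" if \<tau>: "clique V E \<tau>" for \<tau>
  proof (cases "card \<tau> = 0")
    case True
    then have "\<tau> = {}" using \<tau> fin by (auto simp: clique_def dest: finite_subset)
    then show ?thesis using assms(4) link_eq[OF \<tau>] by simp
  next
    case False
    then show ?thesis
      using assms(5)[OF _ _ \<tau> refl] clique_card_le[OF assms(1) \<tau>] assms(3) by simp
  qed
  \<comment> \<open>A clique of maximum size has empty link. As \<open>l d\<close> is a factor of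
    the prefactor in \<open>ext_series l (Suc d)\<close>, the recursion closes at
    \<open>d\<close>.\<close>
  have "l d = 0"
    using max_clique_exists[OF assms(1)] link link_max_clique[OF assms(1)] assms(3)
    by (metis card.empty)
  then have zero: "ext_series l (Suc d) = 0" by (simp add: ext_series_def)
  \<comment> \<open>Geodesics are the extensions of the empty word, whose state is the empty clique
    and whose prefactor is the empty product.\<close>
  have growth: "geodesic_growth_series V E = ext_series l 0"
    using card_extensions[OF fin link, of "[]"]
    by (simp add: geodesic_growth_series_def ext_series_def racg_geodesic_iff_reduced[OF assms(1)]
        top_set_def conj_ac)
  have den: "fps_of_poly (\<Sum>i=0..d. monom (coeff_M l d i 0) i) = chain_series l d 0"
    by (simp add: fps_of_poly_sum fps_of_poly_monom_eq chain_series_eq_coeff_M)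
  have "fps_of_poly (\<Sum>i=0..d. monom (\<Sum>j=0..i. ?L j * coeff_M l d i j) i) =
    (\<Sum>i\<le>d. \<Sum>j\<le>i. fps_const (?L j * coeff_M l d i j) * fps_X ^ i)"
  proof -
    have "fps_const (\<Sum>j\<in>A. g j) = (\<Sum>j\<in>A. fps_const (g j :: rat))" for A :: "nat set" and g
      by (induction A rule: infinite_finite_induct) (simp_all flip: fps_const_add)
    then show ?thesis
      by (simp add: fps_of_poly_sum fps_of_poly_monom_eq atLeast0AtMost sum_distrib_right)
  qed
  also have "\<dots> = (\<Sum>j\<le>d. \<Sum>i=j..d. fps_const (?L j * coeff_M l d i j) * fps_X ^ i)"
    unfolding sum.Sigma[OF finite_atMost ballI[OF finite_atMost]]
      sum.Sigma[OF finite_atMost ballI[OF finite_atLeastAtMost]]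
    by (rule sum.reindex_bij_witness[of _ prod.swap prod.swap]) auto
  also have "\<dots> = (\<Sum>j\<le>d. fps_const (?L j) * fps_X ^ j * chain_series l d j)"
  proof (intro sum.cong refl)
    fix j assume "j \<in> {..d}"
    then have "fps_const (?L j) * fps_X ^ j * chain_series l d j =
      (\<Sum>i=j..d. fps_const (?L j) * fps_X ^ j * (fps_const (coeff_M l d i j) * fps_X ^ (i - j)))"
      by (simp add: chain_series_eq_coeff_M sum_distrib_left)
    also have "\<dots> = (\<Sum>i=j..d. fps_const (?L j * coeff_M l d i j) * fps_X ^ i)"
    proof (intro sum.cong refl)
      fix i assume "i \<in> {j..d}"
      then have "(fps_X :: rat fps) ^ i = fps_X ^ j * fps_X ^ (i - j)"
        by (simp flip: power_add)
      then show "fps_const (?L j) * fps_X ^ j * (fps_const (coeff_M l d i j) * fps_X ^ (i - j)) =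
        fps_const (?L j * coeff_M l d i j) * fps_X ^ i"
        by (simp add: mult_ac flip: fps_const_mult)
    qed
    finally show "(\<Sum>i=j..d. fps_const (?L j * coeff_M l d i j) * fps_X ^ i) =
      fps_const (?L j) * fps_X ^ j * chain_series l d j" ..
  qed
  also have "\<dots> = ext_series l 0 * chain_series l d 0"
    using ext_series_chain_series[OF zero] by simp
  finally have num: "fps_of_poly (\<Sum>i=0..d. monom (\<Sum>j=0..i. ?L j * coeff_M l d i j) i) =
    ext_series l 0 * chain_series l d 0" .
  \<comment> \<open>The denominator has constant term 1, so it is nonzero and cancels from the
    product in \<open>num\<close>.\<close>
  have "fps_nth (chain_series l d 0) 0 = coeff_M l d 0 0"
    unfolding den[symmetric] by (simp add: coeff_sum)
  then have "chain_series l d 0 \<noteq> 0"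
    by (auto simp: coeff_M_def)
  then show ?thesis
    unfolding growth den num by simp
qed

end
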